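(* Let $k_{\mathrm{eff}}$ be the effective stiffness of the variable-order fractional vibrator $$m\frac{d^{\alpha(\omega)}x(t)}{dt^{\alpha(\omega)}}+c\frac{d^{\beta(\omega)}x(t)}{dt^{\beta(\omega)}}+k\frac{d^{\lambda(\omega)}x(t)}{dt^{\lambda(\omega)}}=f(t),\qquad 1<\alpha(\omega)<3,\ 0<\beta(\omega)<2,\ 0\le\lambda(\omega)<1.$$ Then $$k_{\mathrm{eff}}=k\omega^{\lambda(\omega)}\cos\frac{\lambda(\omega)\pi}{2}.$$
   Context: $m,c,k>0$ are constants (primary mass, damping coefficient, stiffness), $\omega>0$ is the vibration frequency, and $\alpha,\beta,\lambda$ are real functions of $\omega$. Derivatives of fractional order are Weyl derivatives: the Fourier transform of the derivative of order $v(\omega)$ of $x$ is $(i\omega)^{v(\omega)}X(\omega)$, with principal value $i^v=\cos\frac{v\pi}{2}+i\sin\frac{v\pi}{2}$. The vibrator's equivalent motion equation (the left-hand sides having equal Fourier transforms, with $\omega$-dependent coefficients acting by multiplication in the Fourier domain) is $$-\left[m\omega^{\alpha-2}\cos\frac{\alpha\pi}{2}+c\omega^{\beta-2}\cos\frac{\beta\pi}{2}\right]\frac{d^2x}{dt^2}+\left[m\omega^{\alpha-1}\sin\frac{\alpha\pi}{2}+c\omega^{\beta-1}\sin\frac{\beta\pi}{2}+k\omega^{\lambda-1}\sin\frac{\lambda\pi}{2}\right]\frac{dx}{dt}+k\omega^{\lambda}\cos\frac{\lambda\pi}{2}\,x=f(t),$$ where $\alpha=\alpha(\omega)$, $\beta=\beta(\omega)$,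 $\lambda=\lambda(\omega)$. The effective stiffness is by definition the coefficient of $x(t)$ in this equivalent equation. *)

theory Defs
  imports "HOL-Analysis.Analysis"
begin

definition fourier :: "(real \<Rightarrow> real) \<Rightarrow> real \<Rightarrow> complex" where
  "fourier x \<omega> =
     (LINT t|lborel. exp (- (\<i> * complex_of_real \<omega> * complex_of_real t)) * complex_of_real (x t))"

text \<open>
  \<open>has_weyl_derivative v x y\<close>: the signal \<open>y\<close> is the Weyl derivative of \<open>x\<close> of the
  frequency-dependent order \<open>v\<close>. The complex \<open>powr\<close> is the principal branch, so for
  \<open>\<omega> > 0\<close> the factor is \<open>\<omega> powr v \<omega>\<close> times the principal value of \<open>\<i>\<close> to the power
  \<open>v \<omega>\<close>. Signals are real-valued, so their transforms at negative frequencies are the complex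
  conjugates of those at positive ones, and prescribing \<open>\<omega> > 0\<close> determines \<open>y\<close> almost everywhere.
\<close>
definition has_weyl_derivative ::
    "(real \<Rightarrow> real) \<Rightarrow> (real \<Rightarrow> real) \<Rightarrow> (real \<Rightarrow> real) \<Rightarrow> bool" where
  "has_weyl_derivative v x y \<longleftrightarrow>
     integrable lborel x \<and> integrable lborel y \<and>
     (\<forall>\<omega>>0. fourier y \<omega> =
        (\<i> * complex_of_real \<omega>) powr complex_of_real (v \<omega>) * fourier x \<omega>)"

text \<open>
  A second-order left-hand side with frequency-dependent coefficients is represented in the
  Fourier domain, as a function of the frequency and of the values there of the transforms of
  \<open>x''\<close>, \<open>x'\<close> and \<open>x\<close>, in this order.
\<close>
type_synonym second_order_lhs = "real \<Rightarrow> complex \<Rightarrow> complex \<Rightarrow> complex \<Rightarrow> complex"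

definition equivalent_lhs ::
    "real \<Rightarrow> real \<Rightarrow> real \<Rightarrow> (real \<Rightarrow> real) \<Rightarrow> (real \<Rightarrow> real) \<Rightarrow> (real \<Rightarrow> real) \<Rightarrow> second_order_lhs" where
  "equivalent_lhs m c k \<alpha> \<beta> lam \<omega> X2 X1 X =
     - (m * \<omega> powr (\<alpha> \<omega> - 2) * cos (\<alpha> \<omega> * pi / 2)
        + c * \<omega> powr (\<beta> \<omega> - 2) * cos (\<beta> \<omega> * pi / 2)) *\<^sub>R X2
     + (m * \<omega> powr (\<alpha> \<omega> - 1) * sin (\<alpha> \<omega> * pi / 2)
        + c * \<omega> powr (\<beta> \<omega> - 1) * sin (\<beta> \<omega> * pi / 2)
        + k * \<omega> powr (lam \<omega> - 1) * sin (lam \<omega> * pi / 2)) *\<^sub>R X1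
     + (k * \<omega> powr lam \<omega> * cos (lam \<omega> * pi / 2)) *\<^sub>R X"

text \<open>
  The left-hand side \<open>m * xa + c * xb + k * xl\<close> of the fractional vibrator and
  the second-order left-hand side \<open>L\<close> have equal Fourier transforms, for every signal \<open>x\<close>
  that has the classical and the Weyl derivatives involved.
\<close>
definition equivalent_to_vibrator ::
    "real \<Rightarrow> real \<Rightarrow> real \<Rightarrow> (real \<Rightarrow> real) \<Rightarrow> (real \<Rightarrow> real) \<Rightarrow> (real \<Rightarrow> real) \<Rightarrow> second_order_lhs \<Rightarrow> bool"
  where
  "equivalent_to_vibrator m c k \<alpha> \<beta> lam L \<longleftrightarrow>
     (\<forall>x x1 x2 xa xb xl.
        integrable lborel x \<and> integrable lborel x1 \<and> integrable lborel x2 \<and>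
        (\<forall>t. (x has_real_derivative x1 t) (at t)) \<and>
        (\<forall>t. (x1 has_real_derivative x2 t) (at t)) \<and>
        has_weyl_derivative \<alpha> x xa \<and> has_weyl_derivative \<beta> x xb \<and> has_weyl_derivative lam x xl
        \<longrightarrow> (\<forall>\<omega>>0. fourier (\<lambda>t. m * xa t + c * xb t + k * xl t) \<omega>
              = L \<omega> (fourier x2 \<omega>) (fourier x1 \<omega>) (fourier x \<omega>)))"

definition coefficient_of_x :: "second_order_lhs \<Rightarrow> real \<Rightarrow> real" where
  "coefficient_of_x L \<omega> =
     (THE K. \<exists>A B. \<forall>X2 X1 X. L \<omega> X2 X1 X = A *\<^sub>R X2 + B *\<^sub>R X1 + K *\<^sub>R X)"

text \<open>
  The effective stiffness refers to the particular equation \<open>equivalent_lhs\<close>: equality of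
  Fourier transforms alone does not single out a coefficient of \<open>x\<close>, because a multiple of \<open>x\<close>
  can be traded for a multiple of \<open>x''\<close>.
\<close>
definition effective_stiffness ::
    "real \<Rightarrow> real \<Rightarrow> real \<Rightarrow> (real \<Rightarrow> real) \<Rightarrow> (real \<Rightarrow> real) \<Rightarrow> (real \<Rightarrow> real) \<Rightarrow> real \<Rightarrow> real" where
  "effective_stiffness m c k \<alpha> \<beta> lam = coefficient_of_x (equivalent_lhs m c k \<alpha> \<beta> lam)"

end

theory Submission imports Defs begin

text \<open>
  For \<open>\<omega> > 0\<close> the principal branch gives
  \<open>(\<i> \<omega>) powr v = \<omega> powr v * (cos (v * pi / 2) + \<i> * sin (v * pi / 2))\<close>, while two classical
  derivatives contribute the factors \<open>\<i> \<omega>\<close> and \<open>- \<omega>\<^sup>2\<close>. Hence the real part of a fractional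
  factor acts like a multiple of \<open>x''\<close> (after division by \<open>- \<omega>\<^sup>2\<close>) or of \<open>x\<close> itself, and the
  imaginary part acts like a multiple of \<open>x'\<close> (after division by \<open>\<omega>\<close>). In the equivalent equation
  the real parts of the inertial and damping terms go to \<open>x''\<close> and the real part of the
  restoring term stays with \<open>x\<close>, which is why only \<open>lam\<close> enters the effective stiffness.

  The analytic content is the rule \<open>fourier_derivative\<close> for classical derivatives that are merely
  integrable. It amounts to the vanishing of the integral of the derivative of
  \<open>exp (- \<i> \<omega> t) * x t\<close> (\<open>integral_of_derivative_eq_0\<close>). The coefficient of \<open>x\<close> is well
  defined because a left-hand side determines its coefficients: its value at \<open>X2 = X1 = 0\<close> and
  \<open>X = 1\<close> is the coefficient.
\<close>

text \<open>
  A nonzero limit would keep \<open>norm (g t)\<close> above \<open>norm l / 2\<close> on a half-line, whose measure is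
  infinite.
\<close>
lemma integrable_lborel_limit_at_top_eq_0:
  fixes g :: "real \<Rightarrow> 'a::{banach, second_countable_topology}"
  assumes "integrable lborel g" and "(g \<longlongrightarrow> l) at_top"
  shows "l = 0"
proof (rule ccontr)
  assume "l \<noteq> 0"
  then have pos: "norm l / 2 > 0" and less: "norm l / 2 < norm l"
    by auto
  have "\<forall>\<^sub>F t in at_top. norm l / 2 < norm (g t)"
    using order_tendstoD(1)[OF tendsto_norm[OF assms(2)] less] .
  then obtain T where T: "\<And>t. t \<ge> T \<Longrightarrow> norm l / 2 < norm (g t)"
    by (auto simp: eventually_at_top_linorder)
  have "integrable lborel (\<lambda>t. indicator {T..} t *\<^sub>R (norm l / 2))"
    by (rule Bochner_Integration.integrable_bound[OF assms(1)])
       (use T pos in \<open>auto simp: indicator_def less_imp_le\<close>)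
  from integrable_mult_left[OF this, of "2 / norm l"]
  have "integrable lborel (indicator {T..} :: real \<Rightarrow> real)"
    using \<open>l \<noteq> 0\<close> by simp
  then have "emeasure lborel {T..} < \<infinity>"
    by (simp add: integrable_indicator_iff)
  moreover have "emeasure lborel {T..} \<ge> ennreal (real n)" for n
  proof -
    have "emeasure lborel {T..T + real n} \<le> emeasure lborel {T..}"
      by (rule emeasure_mono) auto
    then show ?thesis by simp
  qed
  ultimately show False
    using ennreal_Ex_less_of_nat[of "emeasure lborel {T..}"]
    by (auto simp: ennreal_of_nat_eq_real_of_nat simp flip: not_less)
qed

text \<open>
  By the fundamental theorem the integral over \<open>{- y..y}\<close> is \<open>g y - g (- y)\<close>. This is an
  integrable function of \<open>y\<close> that converges to the full integral as \<open>y\<close> grows, and an integrable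
  function has no limit at infinity other than zero. As \<open>g'\<close> may be discontinuous, the fundamental
  theorem is used in its Henstock--Kurzweil form; both integrals agree because \<open>g'\<close> is integrable.
\<close>
lemma integral_of_derivative_eq_0:
  fixes g g' :: "real \<Rightarrow> 'a::euclidean_space"
  assumes deriv: "\<And>t. (g has_vector_derivative g' t) (at t)"
    and g: "integrable lborel g" and g': "integrable lborel g'"
  shows "(LINT t|lborel. g' t) = 0"
proof -
  have ftc: "(LINT t|lborel. indicator {- y..y} t *\<^sub>R g' t) = g y - g (- y)" if "y \<ge> 0" for y
  proof -
    have "set_integrable lborel {- y..y} g'"
      unfolding set_integrable_def by (rule integrable_mult_indicator[OF _ g']) simp
    then have "(LINT t|lborel. indicator {- y..y} t *\<^sub>R g' t) = integral {- y..y} g'"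
      using set_borel_integral_eq_integral(2) by (auto simp: set_lebesgue_integral_def)
    also have "(g' has_integral g y - g (- y)) {- y..y}"
      by (rule fundamental_theorem_of_calculus)
         (use that in \<open>auto intro: has_vector_derivative_at_within deriv\<close>)
    then have "integral {- y..y} g' = g y - g (- y)"
      by (rule integral_unique)
    finally show ?thesis .
  qed
  have "((\<lambda>y. LINT t|lborel. indicator {- y..y} t *\<^sub>R g' t) \<longlongrightarrow> (LINT t|lborel. g' t)) at_top"
  proof (rule integral_dominated_convergence_at_top[where w = "\<lambda>t. norm (g' t)"])
    show "AE t in lborel. ((\<lambda>y. indicator {- y..y} t *\<^sub>R g' t) \<longlongrightarrow> g' t) at_top"
    proof (rule AE_I2)
      fix t :: real
      have "\<forall>\<^sub>F y in at_top. indicator {- y..y} t *\<^sub>R g' t = g' t"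
        using eventually_ge_at_top[of "\<bar>t\<bar>"] by eventually_elim (auto simp: abs_le_iff)
      then show "((\<lambda>y. indicator {- y..y} t *\<^sub>R g' t) \<longlongrightarrow> g' t) at_top"
        by (rule tendsto_eventually)
    qed
  qed (use g' in \<open>auto simp: indicator_def intro!: always_eventually\<close>)
  moreover have "\<forall>\<^sub>F y in at_top. (LINT t|lborel. indicator {- y..y} t *\<^sub>R g' t) = g y - g (- y)"
    using eventually_ge_at_top[of 0] by eventually_elim (rule ftc)
  ultimately have lim: "((\<lambda>y. g y - g (- y)) \<longlongrightarrow> (LINT t|lborel. g' t)) at_top"
    using tendsto_cong by force
  have "integrable lborel (\<lambda>y. g (- y))"
    using lborel_integrable_real_affine[OF g, of "- 1" 0] by simp
  then show ?thesis
    using integrable_lborel_limit_at_top_eq_0[OF _ lim] g by auto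
qed

lemma integrable_fourier_kernel:
  fixes x :: "real \<Rightarrow> real"
  assumes "integrable lborel x"
  shows "integrable lborel
           (\<lambda>t. exp (- (\<i> * complex_of_real \<omega> * complex_of_real t)) * complex_of_real (x t))"
  by (rule Bochner_Integration.integrable_bound[OF assms])
     (use assms in \<open>auto simp: norm_mult\<close>)

lemma fourier_add:
  assumes "integrable lborel x" and "integrable lborel y"
  shows "fourier (\<lambda>t. x t + y t) \<omega> = fourier x \<omega> + fourier y \<omega>"
  unfolding fourier_def of_real_add distrib_left
  using assms by (intro Bochner_Integration.integral_add integrable_fourier_kernel)

lemma fourier_cmult: "fourier (\<lambda>t. a * x t) \<omega> = of_real a * fourier x \<omega>"
  unfolding fourier_def by (simp add: mult.left_commute flip: integral_mult_right_zero)

lemma fourier_derivative: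
  assumes x: "integrable lborel x" and x': "integrable lborel x'"
    and deriv: "\<And>t. (x has_real_derivative x' t) (at t)"
  shows "fourier x' \<omega> = \<i> * of_real \<omega> * fourier x \<omega>"
proof -
  define e where "e t = exp (- (\<i> * complex_of_real \<omega> * complex_of_real t))" for t
  have e: "(e has_vector_derivative - (\<i> * of_real \<omega>) * e t) (at t)" for t
    unfolding e_def
    by (rule has_vector_derivative_real_field) (auto intro!: derivative_eq_intros)
  have "((\<lambda>t. complex_of_real (x t)) has_vector_derivative of_real (x' t)) (at t)" for t
    using deriv by (intro has_vector_derivative_of_real)
      (simp add: has_real_derivative_iff_has_vector_derivative)
  from has_vector_derivative_mult[OF e this]
  have prod: "((\<lambda>t. e t * of_real (x t)) has_vector_derivative
      e t * of_real (x' t) - \<i> * of_real \<omega> * (e t * of_real (x t))) (at t)" for t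
    by (simp add: algebra_simps)
  have int: "integrable lborel (\<lambda>t. e t * of_real (x t))"
            "integrable lborel (\<lambda>t. e t * of_real (x' t))"
    unfolding e_def by (intro integrable_fourier_kernel x x')+
  have "0 = (LINT t|lborel. e t * of_real (x' t) - \<i> * of_real \<omega> * (e t * of_real (x t)))"
    using integral_of_derivative_eq_0[OF prod] int by simp
  also have "\<dots> = fourier x' \<omega> - \<i> * of_real \<omega> * fourier x \<omega>"
    using int unfolding fourier_def e_def by (subst Bochner_Integration.integral_diff) auto
  finally show ?thesis by simp
qed

lemma imaginary_powr_of_real:
  assumes "\<omega> > 0"
  shows "(\<i> * complex_of_real \<omega>) powr of_real v =
           of_real (\<omega> powr v) * Complex (cos (v * pi / 2)) (sin (v * pi / 2))"
proof -
  have "Ln (\<i> * of_real \<omega>) = of_real (ln \<omega>) + \<i> * of_real (pi / 2)"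
    using assms Ln_times_of_real[of \<omega> \<i>] by (simp add: mult.commute Ln_of_real)
  then have "(\<i> * of_real \<omega>) powr of_real v
      = exp (of_real (v * ln \<omega>) + \<i> * of_real (v * pi / 2))"
    using assms by (simp add: powr_def algebra_simps)
  also have "\<dots> = of_real (exp (v * ln \<omega>)) * cis (v * pi / 2)"
    by (simp only: exp_add exp_of_real cis_conv_exp)
  finally show ?thesis
    using assms by (simp add: powr_def cis.code)
qed

theorem theorem2p4:
  fixes m c k :: real and \<alpha> \<beta> lam :: "real \<Rightarrow> real"
  assumes "m > 0" and "c > 0" and "k > 0"
    and "\<And>\<omega>. \<omega> > 0 \<Longrightarrow> 1 < \<alpha> \<omega> \<and> \<alpha> \<omega> < 3"
    and "\<And>\<omega>. \<omega> > 0 \<Longrightarrow> 0 < \<beta> \<omega> \<and> \<beta> \<omega> < 2"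
    and "\<And>\<omega>. \<omega> > 0 \<Longrightarrow> 0 \<le> lam \<omega> \<and> lam \<omega> < 1"
  shows "equivalent_to_vibrator m c k \<alpha> \<beta> lam (equivalent_lhs m c k \<alpha> \<beta> lam) \<and>
    (\<forall>\<omega>>0. effective_stiffness m c k \<alpha> \<beta> lam \<omega> = k * \<omega> powr lam \<omega> * cos (lam \<omega> * pi / 2))"
proof (intro conjI allI impI)
  show "equivalent_to_vibrator m c k \<alpha> \<beta> lam (equivalent_lhs m c k \<alpha> \<beta> lam)"
    unfolding equivalent_to_vibrator_def
  proof (intro allI impI, elim conjE)
    fix x x1 x2 xa xb xl :: "real \<Rightarrow> real" and \<omega> :: real
    assume \<omega>: "\<omega> > 0"
      and int: "integrable lborel x" "integrable lborel x1" "integrable lborel x2"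
      and d1: "\<forall>t. (x has_real_derivative x1 t) (at t)"
      and d2: "\<forall>t. (x1 has_real_derivative x2 t) (at t)"
      and weyl: "has_weyl_derivative \<alpha> x xa" "has_weyl_derivative \<beta> x xb"
        "has_weyl_derivative lam x xl"
    define X where "X = fourier x \<omega>"
    have X1: "fourier x1 \<omega> = \<i> * of_real \<omega> * X"
      unfolding X_def using fourier_derivative int d1 by blast
    have "fourier x2 \<omega> = \<i> * of_real \<omega> * fourier x1 \<omega>"
      using fourier_derivative int d2 by blast
    then have X2: "fourier x2 \<omega> = - of_real (\<omega>\<^sup>2) * X"
      by (simp add: X1 power2_eq_square complex_eq_iff)
    have lhs: "fourier (\<lambda>t. m * xa t + c * xb t + k * xl t) \<omega>
        = of_real m * fourier xa \<omega> + of_real c * fourier xb \<omega> + of_real k * fourier xl \<omega>"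
      using weyl by (simp add: has_weyl_derivative_def fourier_add fourier_cmult)
    have weyl_X:
      "fourier xa \<omega> = (\<i> * of_real \<omega>) powr of_real (\<alpha> \<omega>) * X"
      "fourier xb \<omega> = (\<i> * of_real \<omega>) powr of_real (\<beta> \<omega>) * X"
      "fourier xl \<omega> = (\<i> * of_real \<omega>) powr of_real (lam \<omega>) * X"
      using weyl \<omega> by (simp_all add: has_weyl_derivative_def X_def)
    have shift: "\<omega> powr (v - 2) = \<omega> powr v / \<omega>\<^sup>2" "\<omega> powr (v - 1) = \<omega> powr v / \<omega>" for v
      using \<omega> by (simp_all add: powr_diff powr_numeral)
    show "fourier (\<lambda>t. m * xa t + c * xb t + k * xl t) \<omega>
        = equivalent_lhs m c k \<alpha> \<beta> lam \<omega> (fourier x2 \<omega>) (fourier x1 \<omega>) (fourier x \<omega>)"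
      unfolding lhs weyl_X imaginary_powr_of_real[OF \<omega>] X1 X2 X_def[symmetric]
        equivalent_lhs_def shift
      using \<omega> by (simp add: complex_eq_iff field_simps)
  qed
next
  fix \<omega> :: real
  define A B K where
    "A = - (m * \<omega> powr (\<alpha> \<omega> - 2) * cos (\<alpha> \<omega> * pi / 2)
           + c * \<omega> powr (\<beta> \<omega> - 2) * cos (\<beta> \<omega> * pi / 2))"
    and "B = m * \<omega> powr (\<alpha> \<omega> - 1) * sin (\<alpha> \<omega> * pi / 2)
           + c * \<omega> powr (\<beta> \<omega> - 1) * sin (\<beta> \<omega> * pi / 2)
           + k * \<omega> powr (lam \<omega> - 1) * sin (lam \<omega> * pi / 2)"
    and "K = k * \<omega> powr lam \<omega> * cos (lam \<omega> * pi / 2)"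
  have L: "equivalent_lhs m c k \<alpha> \<beta> lam \<omega> X2 X1 X = A *\<^sub>R X2 + B *\<^sub>R X1 + K *\<^sub>R X" for X2 X1 X
    by (simp only: equivalent_lhs_def A_def B_def K_def)
  have "coefficient_of_x (equivalent_lhs m c k \<alpha> \<beta> lam) \<omega> = K"
    unfolding coefficient_of_x_def
  proof (rule the_equality)
    show "\<exists>A B. \<forall>X2 X1 X. equivalent_lhs m c k \<alpha> \<beta> lam \<omega> X2 X1 X
        = A *\<^sub>R X2 + B *\<^sub>R X1 + K *\<^sub>R X"
      using L by blast
  next
    fix K'
    assume "\<exists>A B. \<forall>X2 X1 X. equivalent_lhs m c k \<alpha> \<beta> lam \<omega> X2 X1 X
        = A *\<^sub>R X2 + B *\<^sub>R X1 + K' *\<^sub>R X"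
    then obtain A' B' where
      "\<forall>X2 X1 X. equivalent_lhs m c k \<alpha> \<beta> lam \<omega> X2 X1 X
        = A' *\<^sub>R X2 + B' *\<^sub>R X1 + K' *\<^sub>R X"
      by blast
    from this[rule_format, of 0 0 1] show "K' = K" by (simp add: L)
  qed
  then show "effective_stiffness m c k \<alpha> \<beta> lam \<omega> = k * \<omega> powr lam \<omega> * cos (lam \<omega> * pi / 2)"
    by (simp add: effective_stiffness_def K_def)
qed

end
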